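(* Let $\Omega$ be a connected open region of the complex plane $\mathbb{C}$ and let $E$ be a bounded nonempty continuum in $\overline\Omega$ whose closure $\overline E$ does not enclose any points of $\Omega\setminus\overline E$. Let $\varepsilon>0$. Then the condition that $g$ is an analytic function in $\Omega\cup E$ satisfying $\|g\|_E\le\varepsilon$ implies no bounds whatsoever on the value of $g$ at any point $z\in\Omega\setminus\overline E$; that is, for every $z\in\Omega\setminus\overline E$ and every $M>0$ there exists a function $g$, analytic in $\Omega\cup E$, with $\|g\|_E\le\varepsilon$ and $|g(z)|\ge M$.
   Context: For a set $A\subset\mathbb{C}$, $\|g\|_A=\sup_{\zeta\in A}|g(\zeta)|$. Overlines denote closures in $\mathbb{C}$. The continuum $E$ is a connected set and is not required to be closed (for example, an open line segment is allowed). A point is enclosed by $\overline E$ if it lies in a bounded connected component of $\mathbb{C}\setminus\overline E$. A function is analytic in $\Omega\cup E$ if it is analytic in $\Omega$ and extends analytically to $E$, i.e. it is the restriction of a function analytic in an open set containing $\Omega\cup E$. *)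

theory Defs
  imports "HOL-Complex_Analysis.Complex_Analysis"
begin

text \<open>
  The supremum is taken in the extended nonnegative reals, so that it has its intended value
  \<open>\<infinity>\<close> when \<open>g\<close> is unbounded on \<open>A\<close> (on type \<^typ>\<open>real\<close> it would be unspecified).
\<close>

definition sup_norm_on :: "complex set \<Rightarrow> (complex \<Rightarrow> complex) \<Rightarrow> ennreal" where
  "sup_norm_on A g = (SUP \<zeta>\<in>A. ennreal (cmod (g \<zeta>)))"

text \<open>
  Two library notions carry the remaining conventions. \<^term>\<open>inside S\<close> is the set of points outside
  \<open>S\<close> whose connected component in \<^term>\<open>- S\<close> is bounded, i.e. the points enclosed by \<open>S\<close>.
  \<^prop>\<open>g analytic_on S\<close>, for an arbitrary set \<open>S\<close>, means that \<open>g\<close> is holomorphic on some open set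
  containing \<open>S\<close> (fact \<open>analytic_on_holomorphic\<close>).
\<close>

end

theory Submission
  imports Defs
begin

text \<open>
  A point \<open>z\<close> of the unbounded component of the complement of \<open>K = closure E\<close> can be separated from
  \<open>K\<close> by entire functions: for each \<open>\<delta> > 0\<close> there is an entire \<open>f\<close> with \<open>f z = 1\<close> and \<open>\<bar>f\<bar> \<le> \<delta>\<close> on
  \<open>K\<close>. A large power of \<open>w / z\<close> does this for \<open>z\<close> far away, and the property is carried along the
  component by Runge's pole pushing. Scaling such an \<open>f\<close> gives the function \<open>g\<close>.
\<close>

definition entire_separable :: "complex set \<Rightarrow> complex \<Rightarrow> bool" where
  "entire_separable K z \<longleftrightarrow>
    (\<forall>\<delta>>0. \<exists>f. f holomorphic_on UNIV \<and> f z = 1 \<and> (\<forall>w\<in>K. cmod (f w) \<le> \<delta>))"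

lemma entire_separable_far:
  assumes K: "\<And>w. w \<in> K \<Longrightarrow> cmod w \<le> R" and z: "cmod z > R" "z \<noteq> 0"
  shows "entire_separable K z"
  unfolding entire_separable_def
proof (intro allI impI)
  fix \<delta> :: real assume "\<delta> > 0"
  \<comment> \<open>\<open>R\<close> may be negative when \<open>K\<close> is empty, hence the
    \<open>max\<close>.\<close>
  define r where "r = max R 0 / cmod z"
  have "0 \<le> r" "r < 1"
    using z by (auto simp: r_def)
  then obtain n where n: "r ^ n < \<delta>"
    using real_arch_pow_inv[OF \<open>\<delta> > 0\<close>] by blast
  have "cmod ((w / z) ^ n) \<le> \<delta>" if "w \<in> K" for w
  proof -
    have "cmod (w / z) \<le> r"
      unfolding r_def norm_divide using K[OF that] by (intro divide_right_mono) auto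
    then have "cmod (w / z) ^ n \<le> r ^ n"
      by (intro power_mono) auto
    with n show ?thesis by (simp add: norm_power)
  qed
  moreover have "(\<lambda>w. (w / z) ^ n) holomorphic_on UNIV"
    using z by (intro holomorphic_intros) auto
  ultimately show "\<exists>f. f holomorphic_on UNIV \<and> f z = 1 \<and> (\<forall>w\<in>K. cmod (f w) \<le> \<delta>)"
    using z by (intro exI[of _ "\<lambda>w. (w / z) ^ n"]) auto
qed

text \<open>
  If \<open>q x = 1\<close> and \<open>q\<close> is small on \<open>K\<close>, then \<open>p w = (1 - q w) / (w - x)\<close> is entire and close to
  \<open>1 / (w - x)\<close> on \<open>K\<close>; inserting \<open>p\<close> into the truncated geometric series for \<open>1 / (w - y)\<close> moves
  the pole from \<open>x\<close> to \<open>y\<close>.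
\<close>

lemma entire_separable_step:
  assumes x: "entire_separable K x" "x \<notin> K"
    and near: "\<And>w. w \<in> K \<Longrightarrow> 2 * cmod (y - x) \<le> cmod (w - x)"
  shows "entire_separable K y"
  unfolding entire_separable_def
proof (intro allI impI)
  fix \<delta> :: real assume "\<delta> > 0"
  obtain n where n: "(3/4 :: real) ^ n < \<delta> / 2"
    using real_arch_pow_inv[of "\<delta> / 2" "3/4"] \<open>\<delta> > 0\<close> by auto
  \<comment> \<open>The bound 1/2 forces \<open>cmod u \<le> 3/4\<close> below; the bound
    \<delta>/8, times 4 for the geometric sum, costs \<delta>/2 and leaves \<delta>/2 for
    \<open>u ^ n\<close>.\<close>
  have "min (1/2) (\<delta>/8) > 0"
    using \<open>\<delta> > 0\<close> by simp
  then obtain q where q: "q holomorphic_on UNIV" "q x = 1"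
      "\<And>w. w \<in> K \<Longrightarrow> cmod (q w) \<le> min (1/2) (\<delta>/8)"
    using x(1) unfolding entire_separable_def by blast
  \<comment> \<open>The derivative fills the removable singularity at \<open>x\<close>, so
    \<open>p\<close> is entire.\<close>
  define p where "p = (\<lambda>w. - (if w = x then deriv q x else (q w - q x) / (w - x)))"
  define f where "f = (\<lambda>w. 1 - (w - y) * p w * (\<Sum>k<n. ((y - x) * p w) ^ k))"
  have "p holomorphic_on UNIV"
    unfolding p_def by (intro holomorphic_on_minus pole_lemma_open q) auto
  then have f: "f holomorphic_on UNIV"
    unfolding f_def by (intro holomorphic_intros) auto
  have "cmod (f w) \<le> \<delta>" if w: "w \<in> K" for w
  proof -
    define u where "u = (y - x) * p w"
    define S where "S = (\<Sum>k<n. u ^ k)"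
    have wx: "w \<noteq> x" using w x(2) by blast
    then have p: "(w - x) * p w = 1 - q w"
      by (simp add: p_def q(2))
    then have "(w - y) * p w = 1 - q w - u"
      by (simp add: u_def algebra_simps)
    then have "f w = 1 - (1 - q w - u) * S"
      by (simp add: f_def S_def u_def)
    \<comment> \<open>Telescoping gives \<open>(1 - u) * S = 1 - u ^ n\<close>. What remains is the
      truncation error \<open>u ^ n\<close> and the error \<open>q w * S\<close> of \<open>p\<close>
      as a substitute for the pole.\<close>
    also have "\<dots> = u ^ n + q w * S"
      using one_diff_power_eq[of u n] by (simp add: S_def algebra_simps)
    finally have fw: "f w = u ^ n + q w * S" .
    have "cmod (1 - q w) \<le> 3/2"
      using norm_triangle_ineq4[of 1 "q w"] q(3)[OF w] by simp
    then have "2 * cmod (y - x) * cmod (1 - q w) \<le> 2 * cmod (y - x) * (3/2)"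
      by (intro mult_left_mono) auto
    then have "2 * cmod u * cmod (w - x) \<le> 2 * cmod (y - x) * (3/2)"
      by (simp add: u_def p[symmetric] norm_mult mult_ac)
    also have "\<dots> \<le> cmod (w - x) * (3/2)"
      using near[OF w] by simp
    finally have u: "cmod u \<le> 3/4"
      using wx by (simp add: field_simps)
    have "cmod S \<le> (\<Sum>k<n. (3/4) ^ k)"
      unfolding S_def using u by (intro sum_norm_le) (simp add: norm_power power_mono)
    also have "\<dots> \<le> 4"
    proof -
      have "(1 - 3/4) * (\<Sum>k<n. (3/4 :: real) ^ k) \<le> 1"
        unfolding one_diff_power_eq[symmetric] by simp
      then show ?thesis by simp
    qed
    finally have "cmod (q w * S) \<le> \<delta>/8 * 4"
      unfolding norm_mult using q(3)[OF w] by (intro mult_mono) (use \<open>\<delta> > 0\<close> in auto)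
    moreover have "cmod (u ^ n) \<le> (3/4) ^ n"
      using u by (simp add: norm_power power_mono)
    ultimately show ?thesis
      unfolding fw using norm_triangle_ineq[of "u ^ n" "q w * S"] n by simp
  qed
  moreover have "f y = 1" by (simp add: f_def)
  ultimately show "\<exists>f. f holomorphic_on UNIV \<and> f y = 1 \<and> (\<forall>w\<in>K. cmod (f w) \<le> \<delta>)"
    using f by blast
qed

text \<open>Any two points of \<open>C\<close> in a small enough ball satisfy the step condition, so
  separability is locally constant on \<open>C\<close>.\<close>

lemma entire_separable_connected:
  assumes "closed K" "connected C" "C \<inter> K = {}" "x \<in> C" "y \<in> C" "entire_separable K x"
  shows "entire_separable K y"
proof (rule connected_induction_simple[where P = "entire_separable K", OF assms(2,4,5,6)])
  fix a assume a: "a \<in> C"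
  then obtain d where d: "d > 0" "ball a d \<subseteq> - K"
    using assms(1,3) by (metis ComplI disjoint_iff open_Compl open_contains_ball)
  \<comment> \<open>Radius d/5 gives \<open>dist t s < 2*d/5\<close> and
    \<open>dist w s > 4*d/5\<close>, the factor 2 of the step.\<close>
  have "entire_separable K t"
    if s: "s \<in> C \<inter> ball a (d/5)" and t: "t \<in> C \<inter> ball a (d/5)" and "entire_separable K s" for s t
  proof (rule entire_separable_step[of K s])
    show "s \<notin> K" using s assms(3) by blast
    fix w assume "w \<in> K"
    then have "d \<le> dist a w" using d(2) by (meson ComplD mem_ball not_le subsetD)
    moreover have "dist a s < d/5" "dist a t < d/5" using s t by auto
    ultimately have "2 * dist t s \<le> dist w s"
      using dist_triangle2[of a w s] dist_triangle3[of t s a] by linarith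
    then show "2 * cmod (t - s) \<le> cmod (w - s)" by (simp add: dist_norm)
  qed fact
  moreover have "openin (top_of_set C) (C \<inter> ball a (d/5))" "a \<in> C \<inter> ball a (d/5)"
    using a d(1) by (simp_all add: openin_open_Int)
  ultimately show "\<exists>T. openin (top_of_set C) T \<and> a \<in> T \<and>
      (\<forall>s\<in>T. \<forall>t\<in>T. entire_separable K s \<longrightarrow> entire_separable K t)"
    by blast
qed

lemma entire_separable_outside:
  assumes "compact K" and z: "z \<notin> K" "z \<notin> inside K"
  shows "entire_separable K z"
proof -
  obtain R where R: "R > 0" "\<And>w. w \<in> K \<Longrightarrow> cmod w \<le> R"
    using compact_imp_bounded[OF assms(1)] by (auto simp: bounded_pos)
  define C where "C = connected_component_set (- K) z"
  have "\<not> bounded C"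
    using z by (auto simp: inside_def C_def)
  \<comment> \<open>An unbounded component reaches beyond \<open>R\<close>, where powers of
    \<open>w / x\<close> separate; the property then travels back to \<open>z\<close>.\<close>
  then obtain x where x: "x \<in> C" "cmod x > R"
    unfolding bounded_iff by (meson not_le)
  have "entire_separable K x"
    using R x by (intro entire_separable_far[of K R]) auto
  moreover have "C \<inter> K = {}" "z \<in> C"
    using z connected_component_subset[of "- K" z] by (auto simp: C_def)
  ultimately show ?thesis
    using entire_separable_connected[of K C x z] x compact_imp_closed[OF assms(1)]
    by (simp add: C_def)
qed

theorem theorem5p1:
  fixes \<Omega> E :: "complex set" and \<epsilon> :: real
  assumes "open \<Omega>" and "connected \<Omega>"
    and "connected E" and "bounded E" and "E \<noteq> {}" and "E \<subseteq> closure \<Omega>"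
    and "inside (closure E) \<inter> (\<Omega> - closure E) = {}"
    and "\<epsilon> > 0"
  shows "\<forall>z \<in> \<Omega> - closure E. \<forall>M::real. M > 0 \<longrightarrow>
    (\<exists>g. g analytic_on (\<Omega> \<union> E) \<and> sup_norm_on E g \<le> ennreal \<epsilon> \<and> cmod (g z) \<ge> M)"
proof (intro ballI allI impI)
  fix z and M :: real assume z: "z \<in> \<Omega> - closure E" and M: "M > 0"
  have "entire_separable (closure E) z"
    using z assms(4,7) by (intro entire_separable_outside) auto
  \<comment> \<open>With \<delta> = \<epsilon>/M, multiplying by \<open>M\<close> yields the bound
    \<epsilon> on \<open>E\<close> and modulus \<open>M\<close> at \<open>z\<close>.\<close>
  moreover have "\<epsilon> / M > 0" using M assms(8) by simp
  ultimately obtain f where f: "f holomorphic_on UNIV" "f z = 1"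
      "\<And>w. w \<in> closure E \<Longrightarrow> cmod (f w) \<le> \<epsilon> / M"
    unfolding entire_separable_def by blast
  define g where "g = (\<lambda>w. of_real M * f w)"
  have "g holomorphic_on UNIV"
    unfolding g_def by (intro holomorphic_intros f)
  then have "g analytic_on (\<Omega> \<union> E)"
    using analytic_on_open analytic_on_subset open_UNIV by blast
  moreover have "cmod (g w) \<le> \<epsilon>" if "w \<in> E" for w
    using f(3)[of w] that closure_subset[of E] M by (auto simp: g_def norm_mult field_simps)
  then have "sup_norm_on E g \<le> ennreal \<epsilon>"
    unfolding sup_norm_on_def by (intro SUP_least ennreal_leI)
  moreover have "cmod (g z) \<ge> M"
    using M by (simp add: g_def f(2))
  ultimately show "\<exists>g. g analytic_on (\<Omega> \<union> E) \<and> sup_norm_on E g \<le> ennreal \<epsilon> \<and> cmod (g z) \<ge> M"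
    by blast
qed

end
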